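(* Let $R$ be a commutative unital ring with $0\neq 1$, let $E$ be an algebraically closed field which is an $R$-algebra, and let $(D,S)$ be a multiplicative summation on $R$ to $E$. (a) Let $X\in R[[\sigma]]$ be $S$-transcendental. Then for every $x\in E$ there exists a multiplicative summation $S'$ extending $S$ such that $S'(X)=x$; moreover, $S_{X,x}:D[X]\to E$ is (well-defined and) the unique minimal multiplicative extension of $S$ which maps $X$ to $x$. (b) Let $X\in R[[\sigma]]$ be $S$-algebraic. Then for every root $x\in E$ of $s_X(t)$ there exists a multiplicative summation $S'$ extending $S$ such that $S'(X)=x$; moreover, $S_{X,x}:D[X]\to E$ is (well-defined and) the unique minimal multiplicative extension of $S$ which maps $X$ to $x$. Conversely, if $S'$ is a multiplicative extension of $S$ for which $S'(X)$ is defined, then $S'(X)$ is a root of $s_X(t)$. (c) Let $X\in R[[\sigma]]$ be $S$-infinite. Then $X$ is not in the domain of any multiplicative extension of $S$.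
   Context: A multiplicative summation on $R$ to $E$ is a pair $(D,S)$ where $R[\sigma]\subseteq D\subseteq R[[\sigma]]$, $D$ is an $R$-subalgebra of the formal power series ring $R[[\sigma]]$, $S:D\to E$ is a (unital) $R$-algebra homomorphism, $(1-\sigma)D\subseteq D$, and $S$ vanishes on $(1-\sigma)D$. $(D',S')$ extends $(D,S)$ if $D\subseteq D'$ and $S'|_D=S$. Scalar polynomials. For $P(T)=\sum_k P_kT^k\in D[T]$ put $S(P)(t)=\sum_k S(P_k)t^k\in E[t]$. For $X\in R[[\sigma]]$ let $\mathrm{A}(X;S)=\{P(T)\in D[T] : P(X)=0,\ S(P)(t)\neq 0\}$. A polynomial $P\in \mathrm{A}(X;S)$ for which $\deg S(P)(t)$ is minimal is called $S$-minimal for $X$. The scalar polynomial $s_X(t)\in E[t]$ of $X$ over $S$ is $0$ if $\mathrm{A}(X;S)=\emptyset$; otherwise it is the unique monic polynomial which is a nonzero scalar multiple of $S(P)(t)$ for some (equivalently every) $S$-minimal $P$ for $X$. $X$ is $S$-transcendental if $s_X(t)=0$, $S$-algebraic if $s_X(t)$ is nonconstant, and $S$-infinite if $s_X(t)=1$. For $X\in R[[\sigma]]$ and $x\in E$, $S_{X,x}:D[X]\to E$ denotes the map $P(X)\mapsto S(P)(x)$ for $P(T)\in D[T]$, whenever this is well-defined. *)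

theory Defs
  imports "HOL-Computational_Algebra.Computational_Algebra"
begin

text \<open>
  The ring \<open>R\<close> is the type \<open>'r::comm_ring_1\<close> (whose class includes \<open>0 \<noteq> 1\<close>), and
  \<open>R[[\<sigma>]]\<close> is \<open>'r fps\<close> with \<open>\<sigma> = fps_X\<close>. The \<open>R\<close>-algebra structure on \<open>E\<close> is a scalar
  multiplication \<open>scale\<close>; the \<open>R\<close>-algebra structure on \<open>R[[\<sigma>]]\<close> is multiplication by
  constant series. As \<open>E\<close> is commutative, compatibility in one factor suffices.
\<close>

definition is_algebra :: "('r::comm_ring_1 \<Rightarrow> 'e::comm_ring_1 \<Rightarrow> 'e) \<Rightarrow> bool" where
  "is_algebra scale \<longleftrightarrow> module scale \<and> (\<forall>r x y. scale r (x * y) = scale r x * y)"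

definition fps_subalgebra :: "'r::comm_ring_1 fps set \<Rightarrow> bool" where
  "fps_subalgebra D \<longleftrightarrow>
     0 \<in> D \<and> 1 \<in> D \<and>
     (\<forall>f\<in>D. \<forall>g\<in>D. f + g \<in> D) \<and>
     (\<forall>f\<in>D. \<forall>g\<in>D. f * g \<in> D) \<and>
     (\<forall>r. \<forall>f\<in>D. fps_const r * f \<in> D)"

definition algebra_hom_on ::
  "('r::comm_ring_1 \<Rightarrow> 'e::comm_ring_1 \<Rightarrow> 'e) \<Rightarrow> 'r fps set \<Rightarrow> ('r fps \<Rightarrow> 'e) \<Rightarrow> bool" where
  "algebra_hom_on scale D S \<longleftrightarrow>
     S 1 = 1 \<and>
     (\<forall>f\<in>D. \<forall>g\<in>D. S (f + g) = S f + S g) \<and>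
     (\<forall>f\<in>D. \<forall>g\<in>D. S (f * g) = S f * S g) \<and>
     (\<forall>r. \<forall>f\<in>D. S (fps_const r * f) = scale r (S f))"

text \<open>
  A summation is a domain \<open>D\<close> together with a function \<open>S\<close> whose values outside \<open>D\<close> are
  irrelevant; two summations are therefore the same if their domains coincide and their
  functions agree there.
\<close>

definition mult_summation ::
  "('r::comm_ring_1 \<Rightarrow> 'e::comm_ring_1 \<Rightarrow> 'e) \<Rightarrow> 'r fps set \<Rightarrow> ('r fps \<Rightarrow> 'e) \<Rightarrow> bool" where
  "mult_summation scale D S \<longleftrightarrow>
     range fps_of_poly \<subseteq> D \<and>
     fps_subalgebra D \<and>
     algebra_hom_on scale D S \<and>
     (\<forall>f\<in>D. (1 - fps_X) * f \<in> D) \<and>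
     (\<forall>f\<in>D. S ((1 - fps_X) * f) = 0)"

definition extends_sum ::
  "'r fps set \<Rightarrow> ('r fps \<Rightarrow> 'e) \<Rightarrow> 'r fps set \<Rightarrow> ('r fps \<Rightarrow> 'e) \<Rightarrow> bool" where
  "extends_sum D' S' D S \<longleftrightarrow> D \<subseteq> D' \<and> (\<forall>f\<in>D. S' f = S f)"

definition same_sum ::
  "'r fps set \<Rightarrow> ('r fps \<Rightarrow> 'e) \<Rightarrow> 'r fps set \<Rightarrow> ('r fps \<Rightarrow> 'e) \<Rightarrow> bool" where
  "same_sum D' S' D S \<longleftrightarrow> D' = D \<and> (\<forall>f\<in>D. S' f = S f)"

definition mult_extension ::
  "('r::comm_ring_1 \<Rightarrow> 'e::comm_ring_1 \<Rightarrow> 'e) \<Rightarrow> 'r fps set \<Rightarrow> ('r fps \<Rightarrow> 'e) \<Rightarrow>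
   'r fps set \<Rightarrow> ('r fps \<Rightarrow> 'e) \<Rightarrow> bool" where
  "mult_extension scale D S D' S' \<longleftrightarrow> mult_summation scale D' S' \<and> extends_sum D' S' D S"

definition polys_over :: "'r::comm_ring_1 fps set \<Rightarrow> 'r fps poly set" where
  "polys_over D = {P. \<forall>k. coeff P k \<in> D}"

text \<open>
  \<open>S(P)(t)\<close> is rendered as \<open>map_poly S P\<close>, which for \<open>P\<close> over \<open>D\<close> applies \<open>S\<close> to each
  coefficient because \<open>S 0 = 0\<close>.
\<close>

definition annihilators ::
  "'r::comm_ring_1 fps set \<Rightarrow> ('r fps \<Rightarrow> 'e::comm_ring_1) \<Rightarrow> 'r fps \<Rightarrow> 'r fps poly set" where
  "annihilators D S X = {P \<in> polys_over D. poly P X = 0 \<and> map_poly S P \<noteq> 0}"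

definition S_minimal ::
  "'r::comm_ring_1 fps set \<Rightarrow> ('r fps \<Rightarrow> 'e::comm_ring_1) \<Rightarrow> 'r fps \<Rightarrow> 'r fps poly \<Rightarrow> bool" where
  "S_minimal D S X P \<longleftrightarrow>
     P \<in> annihilators D S X \<and>
     (\<forall>Q \<in> annihilators D S X. degree (map_poly S P) \<le> degree (map_poly S Q))"

definition scalar_poly ::
  "'r::comm_ring_1 fps set \<Rightarrow> ('r fps \<Rightarrow> 'e::field) \<Rightarrow> 'r fps \<Rightarrow> 'e poly" where
  "scalar_poly D S X =
     (if annihilators D S X = {} then 0
      else (THE q. lead_coeff q = 1 \<and>
              (\<exists>P c. S_minimal D S X P \<and> c \<noteq> 0 \<and> q = smult c (map_poly S P))))"

definition S_transcendental ::
  "'r::comm_ring_1 fps set \<Rightarrow> ('r fps \<Rightarrow> 'e::field) \<Rightarrow> 'r fps \<Rightarrow> bool" where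
  "S_transcendental D S X \<longleftrightarrow> scalar_poly D S X = 0"

definition S_algebraic ::
  "'r::comm_ring_1 fps set \<Rightarrow> ('r fps \<Rightarrow> 'e::field) \<Rightarrow> 'r fps \<Rightarrow> bool" where
  "S_algebraic D S X \<longleftrightarrow> degree (scalar_poly D S X) > 0"

definition S_infinite ::
  "'r::comm_ring_1 fps set \<Rightarrow> ('r fps \<Rightarrow> 'e::field) \<Rightarrow> 'r fps \<Rightarrow> bool" where
  "S_infinite D S X \<longleftrightarrow> scalar_poly D S X = 1"

definition adjoin :: "'r::comm_ring_1 fps set \<Rightarrow> 'r fps \<Rightarrow> 'r fps set" where
  "adjoin D X = {poly P X | P. P \<in> polys_over D}"

definition eval_well_defined ::
  "'r::comm_ring_1 fps set \<Rightarrow> ('r fps \<Rightarrow> 'e::comm_ring_1) \<Rightarrow> 'r fps \<Rightarrow> 'e \<Rightarrow> bool" where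
  "eval_well_defined D S X x \<longleftrightarrow>
     (\<forall>P \<in> polys_over D. \<forall>Q \<in> polys_over D. poly P X = poly Q X \<longrightarrow>
        poly (map_poly S P) x = poly (map_poly S Q) x)"

text \<open>The map \<open>S\<^sub>X\<^sub>,\<^sub>x\<close> on \<open>adjoin D X\<close>; meaningful only under \<open>eval_well_defined\<close>.\<close>

definition eval_ext ::
  "'r::comm_ring_1 fps set \<Rightarrow> ('r fps \<Rightarrow> 'e::comm_ring_1) \<Rightarrow> 'r fps \<Rightarrow> 'e \<Rightarrow> 'r fps \<Rightarrow> 'e" where
  "eval_ext D S X x f =
     (THE y. \<exists>P \<in> polys_over D. poly P X = f \<and> y = poly (map_poly S P) x)"

definition mult_extension_at ::
  "('r::comm_ring_1 \<Rightarrow> 'e::comm_ring_1 \<Rightarrow> 'e) \<Rightarrow> 'r fps set \<Rightarrow> ('r fps \<Rightarrow> 'e) \<Rightarrow>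
   'r fps \<Rightarrow> 'e \<Rightarrow> 'r fps set \<Rightarrow> ('r fps \<Rightarrow> 'e) \<Rightarrow> bool" where
  "mult_extension_at scale D S X x D' S' \<longleftrightarrow>
     mult_extension scale D S D' S' \<and> X \<in> D' \<and> S' X = x"

definition minimal_extension_at ::
  "('r::comm_ring_1 \<Rightarrow> 'e::comm_ring_1 \<Rightarrow> 'e) \<Rightarrow> 'r fps set \<Rightarrow> ('r fps \<Rightarrow> 'e) \<Rightarrow>
   'r fps \<Rightarrow> 'e \<Rightarrow> 'r fps set \<Rightarrow> ('r fps \<Rightarrow> 'e) \<Rightarrow> bool" where
  "minimal_extension_at scale D S X x D' S' \<longleftrightarrow>
     mult_extension_at scale D S X x D' S' \<and>
     (\<forall>D'' S''. mult_extension_at scale D S X x D'' S'' \<and> extends_sum D' S' D'' S'' \<longrightarrow>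
        same_sum D'' S'' D' S')"

text \<open>
  ``The unique minimal extension'': it is minimal, it is the only minimal one, and every
  extension sending \<open>X\<close> to \<open>x\<close> in turn extends it. The last clause is listed because in a
  general partial order a unique minimal element need not be least.
\<close>

definition unique_minimal_extension_at ::
  "('r::comm_ring_1 \<Rightarrow> 'e::comm_ring_1 \<Rightarrow> 'e) \<Rightarrow> 'r fps set \<Rightarrow> ('r fps \<Rightarrow> 'e) \<Rightarrow>
   'r fps \<Rightarrow> 'e \<Rightarrow> 'r fps set \<Rightarrow> ('r fps \<Rightarrow> 'e) \<Rightarrow> bool" where
  "unique_minimal_extension_at scale D S X x D' S' \<longleftrightarrow>
     minimal_extension_at scale D S X x D' S' \<and>
     (\<forall>D'' S''. minimal_extension_at scale D S X x D'' S'' \<longrightarrow> same_sum D'' S'' D' S') \<and>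
     (\<forall>D'' S''. mult_extension_at scale D S X x D'' S'' \<longrightarrow> extends_sum D'' S'' D' S')"

end

theory Submission
  imports Defs
begin

text \<open>
  For an \<open>S\<close>-minimal \<open>P\<close>, pseudo-division by \<open>S(P)(t)\<close> can be lifted from \<open>S(D)[t]\<close> to \<open>D[T]\<close>,
  because its coefficients lie in \<open>S(D)\<close>. The remainder lifts to a polynomial vanishing at \<open>X\<close>,
  so by minimality it is zero. Hence \<open>s\<^sub>X\<close> divides \<open>S(Q)(t)\<close> whenever \<open>Q(X) = 0\<close>, which makes
  \<open>Q(X) \<mapsto> S(Q)(x)\<close> well defined at every root \<open>x\<close> of \<open>s\<^sub>X\<close>. Conversely \<open>s\<^sub>X\<close> is itself a scalar
  multiple of some such \<open>S(Q)(t)\<close>, and any extension sends \<open>Q(X) = 0\<close> to \<open>S(Q)(S'(X))\<close>.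
  The transcendental and the infinite case are the instances \<open>s\<^sub>X = 0\<close> and \<open>s\<^sub>X = 1\<close>.
\<close>

text \<open>Serves the uniqueness of \<open>scalar_poly\<close>: normalised images of
  \<open>S\<close>-minimal polynomials divide each other. The cofactor \<open>r\<close> has degree
  0, and comparing leading coefficients makes it 1.\<close>

lemma monic_dvd_antisym:
  fixes p q :: "'a::idom poly"
  assumes "p dvd q" "q dvd p" "lead_coeff p = 1" "lead_coeff q = 1"
  shows "p = q"
proof -
  from assms(1) obtain r where r: "q = p * r" by (elim dvdE)
  have nz: "p \<noteq> 0" "q \<noteq> 0" using assms by auto
  then have "degree p = degree q"
    using assms by (simp add: dvd_imp_degree_le le_antisym)
  then have "degree r = 0" using r nz by (simp add: degree_mult_eq)
  then obtain a where "r = [:a:]" by (elim degree_eq_zeroE)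
  then show ?thesis using r assms by (cases "a = 0") auto
qed

section \<open>Arithmetic of a summation on its domain\<close>

locale multiplicative_summation =
  fixes scale :: "'r::comm_ring_1 \<Rightarrow> 'e::field \<Rightarrow> 'e"
    and D :: "'r fps set" and S :: "'r fps \<Rightarrow> 'e"
  assumes algebra: "is_algebra scale"
    and summation: "mult_summation scale D S"
begin

lemma
  shows zero_mem: "0 \<in> D" and one_mem: "1 \<in> D"
    and add_mem: "f \<in> D \<Longrightarrow> g \<in> D \<Longrightarrow> f + g \<in> D"
    and mult_mem: "f \<in> D \<Longrightarrow> g \<in> D \<Longrightarrow> f * g \<in> D"
    and const_mult_mem: "f \<in> D \<Longrightarrow> fps_const r * f \<in> D"
    and S_one: "S 1 = 1"
    and S_add: "f \<in> D \<Longrightarrow> g \<in> D \<Longrightarrow> S (f + g) = S f + S g"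
    and S_mult: "f \<in> D \<Longrightarrow> g \<in> D \<Longrightarrow> S (f * g) = S f * S g"
    and S_const_mult: "f \<in> D \<Longrightarrow> S (fps_const r * f) = scale r (S f)"
    and poly_mem: "fps_of_poly p \<in> D"
    and S_telescope: "f \<in> D \<Longrightarrow> S ((1 - fps_X) * f) = 0"
  using summation
  unfolding mult_summation_def fps_subalgebra_def algebra_hom_on_def by auto

text \<open>Turns scalar multiplication into a product in \<open>E\<close>, so that
  \<open>R\<close>-linearity of an extension will follow from its multiplicativity and its values on
  constant series.\<close>

lemma scale_eq: "scale r y = scale r 1 * y"
  using algebra unfolding is_algebra_def by (metis mult_1)

lemma S_zero: "S 0 = 0"
  using S_add[OF zero_mem zero_mem] by (metis add_0_right add_left_cancel)

lemma const_mem: "fps_const r \<in> D"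
  using const_mult_mem[OF one_mem, of r] by simp

lemma S_const: "S (fps_const r) = scale r 1"
  using S_const_mult[OF one_mem, of r] by (simp add: S_one)

text \<open>Negation is not among the closure conditions of \<open>fps_subalgebra\<close>; it is the
  product with the constant series -1.\<close>

lemma uminus_mem: "f \<in> D \<Longrightarrow> - f \<in> D"
  using mult_mem[OF const_mem[of "-1"], of f] by (simp flip: fps_const_neg)

lemma S_uminus: "f \<in> D \<Longrightarrow> S (- f) = - S f"
  using S_add[of f "- f"] uminus_mem[of f] by (simp add: S_zero eq_neg_iff_add_eq_0 add.commute)

lemma one_minus_X_mem: "1 - fps_X \<in> D"
  using poly_mem[of "[:1, -1:]"] by (simp add: fps_of_poly_pCons flip: fps_const_neg)

lemma S_one_minus_X: "S (1 - fps_X) = 0"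
  using S_telescope[OF one_mem] by simp

lemma sum_mem: "(\<And>i. i \<in> A \<Longrightarrow> f i \<in> D) \<Longrightarrow> sum f A \<in> D"
  by (induction A rule: infinite_finite_induct) (auto intro: zero_mem add_mem)

lemma S_sum: "(\<And>i. i \<in> A \<Longrightarrow> f i \<in> D) \<Longrightarrow> S (sum f A) = (\<Sum>i\<in>A. S (f i))"
  by (induction A rule: infinite_finite_induct) (auto simp: S_zero S_add sum_mem)

section \<open>The ring \<open>D[T]\<close> and the homomorphism \<open>map_poly S\<close> on
  it\<close>

lemma polys_overD: "P \<in> polys_over D \<Longrightarrow> coeff P k \<in> D"
  by (simp add: polys_over_def)

lemma polys_over_0: "0 \<in> polys_over D"
  by (simp add: polys_over_def zero_mem)

lemma polys_over_pCons_iff: "pCons f P \<in> polys_over D \<longleftrightarrow> f \<in> D \<and> P \<in> polys_over D"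
  by (auto simp: polys_over_def coeff_pCons split: nat.splits)

lemma polys_over_const: "f \<in> D \<Longrightarrow> [:f:] \<in> polys_over D"
  by (simp add: polys_over_pCons_iff polys_over_0)

lemma polys_over_smult: "f \<in> D \<Longrightarrow> P \<in> polys_over D \<Longrightarrow> smult f P \<in> polys_over D"
  by (simp add: polys_over_def mult_mem)

lemma polys_over_monom: "f \<in> D \<Longrightarrow> monom f n \<in> polys_over D"
  by (simp add: polys_over_def zero_mem)

lemma polys_over_add: "P \<in> polys_over D \<Longrightarrow> Q \<in> polys_over D \<Longrightarrow> P + Q \<in> polys_over D"
  by (simp add: polys_over_def add_mem)

lemma polys_over_uminus: "P \<in> polys_over D \<Longrightarrow> - P \<in> polys_over D"
  by (simp add: polys_over_def uminus_mem)

lemma polys_over_diff: "P \<in> polys_over D \<Longrightarrow> Q \<in> polys_over D \<Longrightarrow> P - Q \<in> polys_over D"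
  using polys_over_add[of P "- Q"] polys_over_uminus[of Q] by simp

lemma polys_over_mult: "P \<in> polys_over D \<Longrightarrow> Q \<in> polys_over D \<Longrightarrow> P * Q \<in> polys_over D"
  by (simp add: polys_over_def coeff_mult sum_mem mult_mem)

lemma coeff_map_S: "coeff (map_poly S P) k = S (coeff P k)"
  by (simp add: coeff_map_poly S_zero)

lemma map_S_pCons: "map_poly S (pCons f P) = pCons (S f) (map_poly S P)"
  by (rule poly_eqI) (simp add: coeff_map_S coeff_pCons split: nat.splits)

lemma map_S_monom: "map_poly S (monom f n) = monom (S f) n"
  by (rule poly_eqI) (simp add: coeff_map_S S_zero)

lemma map_S_smult:
  "f \<in> D \<Longrightarrow> P \<in> polys_over D \<Longrightarrow> map_poly S (smult f P) = smult (S f) (map_poly S P)"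
  by (rule poly_eqI) (simp add: coeff_map_S S_mult polys_overD)

lemma map_S_add:
  "P \<in> polys_over D \<Longrightarrow> Q \<in> polys_over D \<Longrightarrow> map_poly S (P + Q) = map_poly S P + map_poly S Q"
  by (rule poly_eqI) (simp add: coeff_map_S S_add polys_overD)

lemma map_S_uminus: "P \<in> polys_over D \<Longrightarrow> map_poly S (- P) = - map_poly S P"
  by (rule poly_eqI) (simp add: coeff_map_S S_uminus polys_overD)

lemma map_S_diff:
  "P \<in> polys_over D \<Longrightarrow> Q \<in> polys_over D \<Longrightarrow> map_poly S (P - Q) = map_poly S P - map_poly S Q"
  using map_S_add[of P "- Q"] polys_over_uminus[of Q] map_S_uminus[of Q] by simp

lemma map_S_mult:
  "P \<in> polys_over D \<Longrightarrow> Q \<in> polys_over D \<Longrightarrow> map_poly S (P * Q) = map_poly S P * map_poly S Q"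
  by (rule poly_eqI) (simp add: coeff_map_S coeff_mult S_sum S_mult mult_mem polys_overD)

section \<open>Divisibility by the scalar polynomial\<close>

lemma S_minimal_dvd:
  assumes min: "S_minimal D S X M" and P: "P \<in> polys_over D" "poly P X = 0"
  shows "map_poly S M dvd map_poly S P"
  using P
\<comment> \<open>The measure is the degree of the image: \<open>S\<close> may kill the top
  coefficients of \<open>P\<close>, so the degree of \<open>P\<close> itself need not drop.\<close>
proof (induction "degree (map_poly S P)" arbitrary: P rule: less_induct)
  case less
  let ?m = "map_poly S M" and ?p = "map_poly S P"
  have M: "M \<in> polys_over D" "poly M X = 0" "?m \<noteq> 0"
    and least: "\<And>Q. Q \<in> annihilators D S X \<Longrightarrow> degree ?m \<le> degree (map_poly S Q)"
    using min by (auto simp: S_minimal_def annihilators_def)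
  show ?case
  proof (cases "?p = 0")
    case False
    define n where "n = degree ?p - degree ?m"
    \<comment> \<open>Minimality enters here: a nonzero \<open>?p\<close> always has large enough
      degree to be reduced by \<open>?m\<close>, so the descent can only end at zero.\<close>
    have le: "degree ?m \<le> degree ?p"
      using least[of P] less.prems False by (simp add: annihilators_def)
    \<comment> \<open>\<open>c\<close> and \<open>b\<close> lift the leading coefficients of
      \<open>?m\<close> and \<open>?p\<close> to \<open>D\<close>. They need not be the leading
      coefficients of \<open>M\<close> and \<open>P\<close>.\<close>
    define c where "c = coeff M (degree ?m)"
    define b where "b = coeff P (degree ?p)"
    \<comment> \<open>Scaling \<open>P\<close> by \<open>c\<close> replaces a division by
      \<open>c\<close>, which may be impossible in \<open>D\<close>; after applying
      \<open>S\<close>, the terms of degree \<open>degree ?p\<close> cancel.\<close>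
    define Q where "Q = smult c P - monom b n * M"
    have cb: "c \<in> D" "b \<in> D"
      using M less.prems by (auto simp: c_def b_def polys_overD)
    have over: "smult c P \<in> polys_over D" "monom b n * M \<in> polys_over D"
      using cb M less.prems by (auto intro: polys_over_mult polys_over_smult polys_over_monom)
    have Sc: "S c = lead_coeff ?m" and Sb: "S b = lead_coeff ?p"
      by (simp_all add: c_def b_def coeff_map_S)
    have c0: "S c \<noteq> 0" using Sc M by simp
    have Q: "Q \<in> polys_over D" "poly Q X = 0"
      using over M less.prems by (auto simp: Q_def polys_over_diff)
    have "map_poly S (smult c P) = smult (S c) ?p"
      using cb less.prems by (simp add: map_S_smult)
    moreover have "map_poly S (monom b n * M) = monom (S b) n * ?m"
      using map_S_mult[OF polys_over_monom[OF cb(2)] M(1)] by (simp add: map_S_monom)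
    ultimately have q: "map_poly S Q = smult (S c) ?p - monom (S b) n * ?m"
      using over by (simp add: Q_def map_S_diff)
    have "?m dvd map_poly S Q"
    proof (cases "map_poly S Q = 0")
      case nz: False
      have "coeff (map_poly S Q) (degree ?p) = 0"
        using le by (simp add: q coeff_monom_mult n_def Sc Sb)
      moreover have "degree (map_poly S Q) \<le> degree ?p"
      proof -
        have "degree (monom (S b) n * ?m) \<le> n + degree ?m"
          by (meson add_right_mono degree_monom_le degree_mult_le order_trans)
        then show ?thesis
          unfolding q using le by (intro degree_diff_le) (auto simp: n_def)
      qed
      ultimately have "degree (map_poly S Q) < degree ?p"
        using nz by (metis le_neq_implies_less leading_coeff_0_iff)
      then show ?thesis using less.hyps Q by blast
    qed simp
    \<comment> \<open>Adding back the subtracted multiple of \<open>?m\<close> leaves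
      \<open>smult (S c) ?p\<close>, and \<open>S c\<close> is a unit of the field
      \<open>E\<close>.\<close>
    then have "?m dvd map_poly S Q + monom (S b) n * ?m"
      by (intro dvd_add dvd_triv_right)
    then have "?m dvd smult (S c) ?p" by (simp add: q)
    then show ?thesis using c0 by (simp add: dvd_smult_iff)
  qed simp
qed

text \<open>Resolves the definite description in \<open>scalar_poly\<close>. A minimal annihilator
  exists because degrees are natural numbers; any two candidates divide each other by
  \<open>S_minimal_dvd\<close> and are monic, hence equal.\<close>

lemma scalar_poly_spec:
  assumes "annihilators D S X \<noteq> {}"
  obtains M c where "S_minimal D S X M" "c \<noteq> 0" "scalar_poly D S X = smult c (map_poly S M)"
proof -
  obtain M where M: "S_minimal D S X M"
    using assms ex_has_least_nat[of "\<lambda>P. P \<in> annihilators D S X" _ "\<lambda>P. degree (map_poly S P)"]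
    unfolding S_minimal_def by blast
  define Good where "Good q \<longleftrightarrow> lead_coeff q = 1 \<and>
    (\<exists>P c. S_minimal D S X P \<and> c \<noteq> 0 \<and> q = smult c (map_poly S P))" for q
  have nz: "map_poly S P \<noteq> 0" and zero: "P \<in> polys_over D" "poly P X = 0"
    if "S_minimal D S X P" for P
    using that by (auto simp: S_minimal_def annihilators_def)
  have good: "Good (smult (inverse (lead_coeff (map_poly S M))) (map_poly S M))"
    unfolding Good_def
    using M nz[OF M] by (intro conjI exI[of _ M] exI[of _ "inverse (lead_coeff (map_poly S M))"]) auto
  have unique: "p = q" if p: "Good p" and q: "Good q" for p q
  proof -
    have "p dvd q" if "Good p" "Good q" for p q
      using that unfolding Good_def
      by (auto intro!: dvd_smult smult_dvd S_minimal_dvd zero)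
    then have "p dvd q" "q dvd p" using p q by auto
    then show ?thesis
      using p q by (intro monic_dvd_antisym) (auto simp: Good_def)
  qed
  have "Good (THE q. Good q)" by (rule theI[of Good, OF good unique[OF _ good]])
  then have "Good (scalar_poly D S X)"
    using assms by (simp add: scalar_poly_def Good_def[abs_def])
  then show ?thesis using that unfolding Good_def by blast
qed

lemma scalar_poly_dvd:
  assumes "P \<in> polys_over D" "poly P X = 0"
  shows "scalar_poly D S X dvd map_poly S P"
proof (cases "annihilators D S X = {}")
  case True
  \<comment> \<open>Since \<open>P\<close> vanishes at \<open>X\<close> without being an
    annihilator, \<open>map_poly S P\<close> is 0, which everything divides.\<close>
  then show ?thesis using assms by (auto simp: annihilators_def)
next
  case False
  then obtain M c where "S_minimal D S X M" "c \<noteq> 0"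
    "scalar_poly D S X = smult c (map_poly S M)"
    by (rule scalar_poly_spec)
  then show ?thesis using assms by (simp add: smult_dvd S_minimal_dvd)
qed

text \<open>Lets an arbitrary extension act on \<open>s\<^sub>X\<close> through a relation satisfied
  by \<open>X\<close>. If there is no annihilator, the zero polynomial serves as the lift.\<close>

lemma scalar_poly_lift:
  obtains P c where "P \<in> polys_over D" "poly P X = 0" "scalar_poly D S X = smult c (map_poly S P)"
proof (cases "annihilators D S X = {}")
  case True
  then show ?thesis using that[of 0 1] by (simp add: polys_over_0 scalar_poly_def)
next
  case False
  then obtain M c where "S_minimal D S X M" "scalar_poly D S X = smult c (map_poly S M)"
    by (rule scalar_poly_spec)
  then show ?thesis using that[of M c] by (simp add: S_minimal_def annihilators_def)
qed

section \<open>Values of an arbitrary extension on \<open>D[X]\<close>\<close>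

lemma extension_poly:
  assumes "mult_extension scale D S D' S'" "X \<in> D'" "P \<in> polys_over D"
  shows "poly P X \<in> D' \<and> S' (poly P X) = poly (map_poly S P) (S' X)"
proof -
  interpret ext: multiplicative_summation scale D' S'
    using assms(1) algebra by unfold_locales (auto simp: mult_extension_def)
  have "D \<subseteq> D'" "\<And>f. f \<in> D \<Longrightarrow> S' f = S f"
    using assms(1) by (auto simp: mult_extension_def extends_sum_def)
  \<comment> \<open>Being a ring homomorphism that agrees with \<open>S\<close> on \<open>D\<close>,
    \<open>S'\<close> is forced on \<open>D[X]\<close> by its value at \<open>X\<close>; the
    induction follows the Horner form of \<open>P\<close>.\<close>
  with assms(2,3) show ?thesis
    by (induction P)
      (auto simp: ext.zero_mem ext.S_zero polys_over_pCons_iff map_S_pCons ext.add_mem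
        ext.mult_mem ext.S_add ext.S_mult)
qed

lemma extension_root:
  assumes "mult_extension scale D S D' S'" "X \<in> D'"
  shows "poly (scalar_poly D S X) (S' X) = 0"
proof -
  interpret ext: multiplicative_summation scale D' S'
    using assms(1) algebra by unfold_locales (auto simp: mult_extension_def)
  obtain P c where P: "P \<in> polys_over D" "poly P X = 0"
    and s: "scalar_poly D S X = smult c (map_poly S P)"
    by (rule scalar_poly_lift)
  from extension_poly[OF assms P(1)] have "poly (map_poly S P) (S' X) = 0"
    by (simp add: P ext.S_zero)
  then show ?thesis by (simp add: s)
qed

section \<open>Construction of the extension \<open>S\<^sub>X\<^sub>,\<^sub>x\<close>\<close>

lemma eval_well_defined_at_root:
  assumes "poly (scalar_poly D S X) x = 0"
  shows "eval_well_defined D S X x"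
  unfolding eval_well_defined_def
proof (intro ballI impI)
  fix P Q assume PQ: "P \<in> polys_over D" "Q \<in> polys_over D" "poly P X = poly Q X"
  then have "scalar_poly D S X dvd map_poly S (P - Q)"
    by (intro scalar_poly_dvd) (auto simp: polys_over_diff)
  then have "poly (map_poly S (P - Q)) x = 0"
    using assms by (auto simp: dvd_def)
  then show "poly (map_poly S P) x = poly (map_poly S Q) x"
    using PQ by (simp add: map_S_diff)
qed

text \<open>Well-definedness supplies the uniqueness for the definite description; later
  computations with \<open>eval_ext\<close> go through this equation.\<close>

lemma eval_ext_poly:
  assumes "eval_well_defined D S X x" "P \<in> polys_over D"
  shows "eval_ext D S X x (poly P X) = poly (map_poly S P) x"
  unfolding eval_ext_def
  using assms unfolding eval_well_defined_def by (intro the_equality) blast+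

lemma adjoinI: "P \<in> polys_over D \<Longrightarrow> poly P X \<in> adjoin D X"
  by (auto simp: adjoin_def)

lemma adjoinE:
  assumes "f \<in> adjoin D X"
  obtains P where "P \<in> polys_over D" "f = poly P X"
  using assms by (auto simp: adjoin_def)

lemma base_subset_adjoin: "D \<subseteq> adjoin D X"
proof
  show "f \<in> adjoin D X" if "f \<in> D" for f
    using adjoinI[OF polys_over_const[OF that], of X] by simp
qed

lemma adjoin_add: "f \<in> adjoin D X \<Longrightarrow> g \<in> adjoin D X \<Longrightarrow> f + g \<in> adjoin D X"
  by (elim adjoinE) (metis adjoinI poly_add polys_over_add)

lemma adjoin_mult: "f \<in> adjoin D X \<Longrightarrow> g \<in> adjoin D X \<Longrightarrow> f * g \<in> adjoin D X"
  by (elim adjoinE) (metis adjoinI poly_mult polys_over_mult)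

lemma
  assumes wd: "eval_well_defined D S X x"
  shows eval_ext_base: "f \<in> D \<Longrightarrow> eval_ext D S X x f = S f"
    and eval_ext_add: "f \<in> adjoin D X \<Longrightarrow> g \<in> adjoin D X \<Longrightarrow>
      eval_ext D S X x (f + g) = eval_ext D S X x f + eval_ext D S X x g"
    and eval_ext_mult: "f \<in> adjoin D X \<Longrightarrow> g \<in> adjoin D X \<Longrightarrow>
      eval_ext D S X x (f * g) = eval_ext D S X x f * eval_ext D S X x g"
proof -
  show "eval_ext D S X x f = S f" if "f \<in> D"
    using eval_ext_poly[OF wd polys_over_const[OF that]] by (simp add: map_S_pCons)
next
  assume "f \<in> adjoin D X" "g \<in> adjoin D X"
  then obtain P Q where PQ: "P \<in> polys_over D" "Q \<in> polys_over D" "f = poly P X" "g = poly Q X"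
    by (auto elim!: adjoinE)
  show "eval_ext D S X x (f + g) = eval_ext D S X x f + eval_ext D S X x g"
    using PQ eval_ext_poly[OF wd, of "P + Q"]
    by (simp add: eval_ext_poly[OF wd] polys_over_add map_S_add)
  show "eval_ext D S X x (f * g) = eval_ext D S X x f * eval_ext D S X x g"
    using PQ eval_ext_poly[OF wd, of "P * Q"]
    by (simp add: eval_ext_poly[OF wd] polys_over_mult map_S_mult)
qed

lemma eval_ext_extension:
  assumes wd: "eval_well_defined D S X x"
  shows "mult_extension_at scale D S X x (adjoin D X) (eval_ext D S X x)"
proof -
  let ?A = "adjoin D X" and ?S = "eval_ext D S X x"
  note base = base_subset_adjoin[THEN subsetD] eval_ext_base[OF wd]
  have X: "[:0, 1:] \<in> polys_over D"
    by (simp add: polys_over_pCons_iff polys_over_0 zero_mem one_mem)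
  have "fps_subalgebra ?A"
    unfolding fps_subalgebra_def
    using adjoin_mult[OF base(1)[OF const_mem]]
    by (auto simp: adjoin_add adjoin_mult intro: base(1) zero_mem one_mem)
  moreover have "algebra_hom_on scale ?A ?S"
    unfolding algebra_hom_on_def
  proof (intro conjI ballI allI)
    show "?S 1 = 1" by (simp add: base(2) one_mem S_one)
    fix f g r assume f: "f \<in> ?A" and g: "g \<in> ?A"
    show "?S (f + g) = ?S f + ?S g" using f g by (rule eval_ext_add[OF wd])
    show "?S (f * g) = ?S f * ?S g" using f g by (rule eval_ext_mult[OF wd])
  next
    fix f r assume f: "f \<in> ?A"
    \<comment> \<open>Linearity over \<open>R\<close> is multiplicativity with a constant series as
      one factor, on which \<open>?S\<close> agrees with \<open>S\<close>.\<close>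
    have "?S (fps_const r * f) = scale r 1 * ?S f"
      using eval_ext_mult[OF wd base(1)[OF const_mem] f] by (simp add: base(2) const_mem S_const)
    also have "\<dots> = scale r (?S f)" by (rule scale_eq[symmetric])
    finally show "?S (fps_const r * f) = scale r (?S f)" .
  qed
  moreover have "\<forall>f\<in>?A. (1 - fps_X) * f \<in> ?A"
    using adjoin_mult[OF base(1)[OF one_minus_X_mem]] by blast
  \<comment> \<open>Since \<open>?S\<close> is multiplicative, it is enough that \<open>S\<close>
    kills the single element \<open>1 - fps_X\<close> of \<open>D\<close>.\<close>
  moreover have "\<forall>f\<in>?A. ?S ((1 - fps_X) * f) = 0"
    using eval_ext_mult[OF wd base(1)[OF one_minus_X_mem]]
    by (simp add: base(2) one_minus_X_mem S_one_minus_X)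
  moreover have "range fps_of_poly \<subseteq> ?A"
    using base(1) poly_mem by blast
  ultimately have "mult_summation scale ?A ?S"
    unfolding mult_summation_def by blast
  moreover have "extends_sum ?A ?S D S"
    using base by (simp add: extends_sum_def subset_iff)
  moreover have "X \<in> ?A" using adjoinI[OF X, of X] by simp
  moreover have "?S X = x"
    using eval_ext_poly[OF wd X] by (simp add: map_S_pCons S_zero S_one)
  ultimately show ?thesis
    by (simp add: mult_extension_at_def mult_extension_def)
qed

section \<open>Minimality, and the three cases\<close>

lemma eval_ext_least:
  assumes wd: "eval_well_defined D S X x" and ext: "mult_extension_at scale D S X x D' S'"
  shows "extends_sum D' S' (adjoin D X) (eval_ext D S X x)"
proof -
  have "poly P X \<in> D' \<and> S' (poly P X) = eval_ext D S X x (poly P X)" if "P \<in> polys_over D" for P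
    using extension_poly[OF _ _ that] ext eval_ext_poly[OF wd that]
    by (auto simp: mult_extension_at_def)
  then show ?thesis by (auto simp: extends_sum_def elim!: adjoinE)
qed

lemma eval_ext_unique_minimal:
  assumes wd: "eval_well_defined D S X x"
  shows "unique_minimal_extension_at scale D S X x (adjoin D X) (eval_ext D S X x)"
proof -
  let ?A = "adjoin D X" and ?S = "eval_ext D S X x"
  note ext = eval_ext_extension[OF wd] and least = eval_ext_least[OF wd]
  have "minimal_extension_at scale D S X x ?A ?S"
    unfolding minimal_extension_at_def
  proof (intro conjI ext allI impI)
    fix D' S'
    assume "mult_extension_at scale D S X x D' S' \<and> extends_sum ?A ?S D' S'"
    then show "same_sum D' S' ?A ?S"
      using least[of D' S'] by (auto simp: extends_sum_def same_sum_def)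
  qed
  moreover have "same_sum D' S' ?A ?S" if min: "minimal_extension_at scale D S X x D' S'" for D' S'
  proof -
    have "extends_sum D' S' ?A ?S"
      using min by (intro least) (simp add: minimal_extension_at_def)
    \<comment> \<open>The minimality of \<open>D'\<close>, \<open>S'\<close> is applied to the
      competitor \<open>?A\<close>, \<open>?S\<close>, which it extends by leastness.\<close>
    then have "same_sum ?A ?S D' S'"
      using min ext unfolding minimal_extension_at_def by blast
    then show ?thesis by (simp add: same_sum_def)
  qed
  ultimately show ?thesis
    using least unfolding unique_minimal_extension_at_def by blast
qed

lemma root_extension:
  assumes "poly (scalar_poly D S X) x = 0"
  shows "(\<exists>D' S'. mult_extension scale D S D' S' \<and> X \<in> D' \<and> S' X = x) \<and>
    eval_well_defined D S X x \<and>
    unique_minimal_extension_at scale D S X x (adjoin D X) (eval_ext D S X x)"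
  using eval_well_defined_at_root[OF assms] eval_ext_extension eval_ext_unique_minimal
  unfolding mult_extension_at_def by blast

end

theorem theorem2p18:
  fixes scale :: "'r::comm_ring_1 \<Rightarrow> 'e::alg_closed_field \<Rightarrow> 'e"
    and D :: "'r fps set" and S :: "'r fps \<Rightarrow> 'e"
  assumes "is_algebra scale"
    and "mult_summation scale D S"
  shows
    "(\<forall>X. S_transcendental D S X \<longrightarrow>
        (\<forall>x. (\<exists>D' S'. mult_extension scale D S D' S' \<and> X \<in> D' \<and> S' X = x) \<and>
             eval_well_defined D S X x \<and>
             unique_minimal_extension_at scale D S X x (adjoin D X) (eval_ext D S X x))) \<and>
     (\<forall>X. S_algebraic D S X \<longrightarrow>
        (\<forall>x. poly (scalar_poly D S X) x = 0 \<longrightarrow>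
             (\<exists>D' S'. mult_extension scale D S D' S' \<and> X \<in> D' \<and> S' X = x) \<and>
             eval_well_defined D S X x \<and>
             unique_minimal_extension_at scale D S X x (adjoin D X) (eval_ext D S X x)) \<and>
        (\<forall>D' S'. mult_extension scale D S D' S' \<and> X \<in> D' \<longrightarrow>
             poly (scalar_poly D S X) (S' X) = 0)) \<and>
     (\<forall>X. S_infinite D S X \<longrightarrow>
        (\<forall>D' S'. mult_extension scale D S D' S' \<longrightarrow> X \<notin> D'))"
proof -
  interpret multiplicative_summation scale D S
    using assms by unfold_locales
  have "\<forall>X. S_transcendental D S X \<longrightarrow> (\<forall>x. poly (scalar_poly D S X) x = 0)"
    by (simp add: S_transcendental_def)
  \<comment> \<open>If \<open>X\<close> were in \<open>D'\<close>, then \<open>S' X\<close> would be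
    a root of the constant polynomial 1.\<close>
  moreover have "\<forall>X. S_infinite D S X \<longrightarrow>
      (\<forall>D' S'. mult_extension scale D S D' S' \<longrightarrow> X \<notin> D')"
    using extension_root by (fastforce simp: S_infinite_def)
  ultimately show ?thesis
    using root_extension extension_root by meson
qed

end
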